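(* Let $n\ge2$, $j\ge1$, $j\not\equiv0\pmod n$. Let $u=\sum_{i=1}^{n-1}u_ie_{in}:\mathbb{R}^2\to V_n$ be a smooth solution of the $j$-th $A^{(1)}_{n-1}$-KdV flow $u_t=[\partial_x+b+u,Z_{j,0}(u)]$, and let $c_0\in SL(n,\mathbb{R})$ be a constant. Let $g:\mathbb{R}^2\to SL(n,\mathbb{R})$ be the solution of $g^{-1}g_x=b+u$, $g^{-1}g_t=Z_{j,0}(u)$, $g(0,0)=c_0$. Then $\gamma(x,t):=g(x,t)e_1$ is a solution of the $j$-th central affine curve flow $\gamma_t=gZ_{j,0}(u)e_1$ on $\mathcal{M}_n(\mathbb{R})$, with central affine curvature $u(\cdot,t)$ for each $t$.
   Context: $\mathcal{M}_n(\mathbb{R})$ is the set of smooth $\gamma:\mathbb{R}\to\mathbb{R}^n\setminus\{0\}$ with $\det(\gamma,\gamma_x,\ldots,\gamma_x^{(n-1)})=1$. For such $\gamma$ the central affine moving frame $g=(\gamma,\ldots,\gamma_x^{(n-1)})$ satisfies $g_x=g(b+u)$ with $b=\sum_{i=1}^{n-1}e_{i+1,i}$ and $u=\sum_{i=1}^{n-1}u_ie_{in}$, where $\gamma_x^{(n)}=u_1\gamma+\cdots+u_{n-1}\gamma_x^{(n-2)}$; $u$ is the central affine curvature. $V_n=\bigoplus_{i=1}^{n-1}\mathbb{R}e_{in}$, $e_1=(1,0,\ldots,0)^t$. The $j$-th central affine curve flow is $\gamma_t=gZ_{j,0}(u)e_1$ for $\gamma(\cdot,t)\in\mathcal{M}_n(\mathbb{R})$,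 with $g(\cdot,t)$, $u(\cdot,t)$ the moving frame and curvature of $\gamma(\cdot,t)$. Let $J=e_{1n}\lambda+b$. For smooth $V_n$-valued $u$, let $Y(u,\lambda)=e_{1n}\lambda+\sum_{i\le 0}Y_{1,i}(u)\lambda^i$ be the unique formal series with smooth $sl(n)$-valued coefficients satisfying $Y_x+[J+u,Y]=0$ and $Y^n=\lambda I_n$; its coefficients are differential polynomials in $u$ (in the variable $x$). Write $Y(u,\lambda)^j=\sum_i Y_{j,i}(u)\lambda^i$. There is a unique strictly upper triangular $\zeta_j(u)$ (entries differential polynomials in $u$) with $[\partial_x+b+u,\,Y_{j,0}(u)-\zeta_j(u)]\in V_n$, where $[\partial_x+A,B]=B_x+[A,B]$. Set $Z_{j,0}(u)=Y_{j,0}(u)-\zeta_j(u)$. *)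

theory Defs
  imports
    "HOL-Analysis.Derivative"
    "HOL-Computational_Algebra.Formal_Laurent_Series"
    "Jordan_Normal_Form.Determinant"
begin

no_notation fls_nth (infixl \<open>$$\<close> 75)
no_notation fps_nth (infixl \<open>$\<close> 75)

text \<open>
  Matrices and vectors are indexed from 0, so the mathematical entry \<open>(i, k)\<close> with
  \<open>1 \<le> i, k \<le> n\<close> is the entry \<open>(i - 1, k - 1)\<close> here.
\<close>

section \<open>Smoothness and derivatives\<close>

definition smooth :: "(real \<Rightarrow> real) \<Rightarrow> bool" where
  "smooth f \<longleftrightarrow> (\<forall>k x. (deriv ^^ k) f differentiable (at x))"

text \<open>
  Smoothness on the plane: the largest class of continuous functions whose two partial
  derivatives exist everywhere and belong to the class again, i.e. all iterated partial
  derivatives exist and are continuous.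
\<close>

coinductive smooth2 :: "(real \<Rightarrow> real \<Rightarrow> real) \<Rightarrow> bool" where
  "\<lbrakk>continuous_on UNIV (\<lambda>(x, t). f x t);
    \<And>x t. ((\<lambda>s. f s t) has_real_derivative fx x t) (at x);
    \<And>x t. ((\<lambda>s. f x s) has_real_derivative ft x t) (at t);
    smooth2 fx; smooth2 ft\<rbrakk> \<Longrightarrow> smooth2 f"

definition smooth_mat :: "nat \<Rightarrow> (real \<Rightarrow> real mat) \<Rightarrow> bool" where
  "smooth_mat n A \<longleftrightarrow> (\<forall>p<n. \<forall>q<n. smooth (\<lambda>x. A x $$ (p, q)))"

definition smooth2_mat :: "nat \<Rightarrow> (real \<Rightarrow> real \<Rightarrow> real mat) \<Rightarrow> bool" where
  "smooth2_mat n A \<longleftrightarrow> (\<forall>p<n. \<forall>q<n. smooth2 (\<lambda>x t. A x t $$ (p, q)))"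

definition mat_deriv :: "nat \<Rightarrow> (real \<Rightarrow> real mat) \<Rightarrow> real \<Rightarrow> real mat" where
  "mat_deriv n A x = mat n n (\<lambda>(p, q). deriv (\<lambda>s. A s $$ (p, q)) x)"

definition vec_deriv :: "nat \<Rightarrow> (real \<Rightarrow> real vec) \<Rightarrow> real \<Rightarrow> real vec" where
  "vec_deriv n v x = vec n (\<lambda>p. deriv (\<lambda>s. v s $ p) x)"

section \<open>Matrices\<close>

definition SL :: "nat \<Rightarrow> real mat set" where
  "SL n = {A \<in> carrier_mat n n. det A = 1}"

definition sl :: "nat \<Rightarrow> real mat set" where
  "sl n = {A \<in> carrier_mat n n. (\<Sum>p<n. A $$ (p, p)) = 0}"

definition strictly_upper :: "nat \<Rightarrow> real mat set" where
  "strictly_upper n = {A \<in> carrier_mat n n. \<forall>p<n. \<forall>q\<le>p. A $$ (p, q) = 0}"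

text \<open>The matrix unit \<open>e\<^bsub>1n\<^esub>\<close> and the matrix \<open>b\<close>, the sum of the \<open>e\<^bsub>i+1,i\<^esub>\<close>.\<close>

definition e1n :: "nat \<Rightarrow> 'a :: {zero, one} mat" where
  "e1n n = mat n n (\<lambda>(p, q). if p = 0 \<and> q = n - 1 then 1 else 0)"

definition bmat :: "nat \<Rightarrow> 'a :: {zero, one} mat" where
  "bmat n = mat n n (\<lambda>(p, q). if p = q + 1 then 1 else 0)"

definition V :: "nat \<Rightarrow> real mat set" where
  "V n = {A \<in> carrier_mat n n. \<forall>p<n. \<forall>q<n. \<not> (p < n - 1 \<and> q = n - 1) \<longrightarrow> A $$ (p, q) = 0}"

definition comm :: "'a :: ring mat \<Rightarrow> 'a mat \<Rightarrow> 'a mat" where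
  "comm A B = A * B - B * A"

text \<open>\<open>dx_comm n A B\<close> is \<open>[\<partial>\<^sub>x + A, B] = B\<^sub>x + [A, B]\<close>.\<close>

definition dx_comm ::
  "nat \<Rightarrow> (real \<Rightarrow> real mat) \<Rightarrow> (real \<Rightarrow> real mat) \<Rightarrow> real \<Rightarrow> real mat" where
  "dx_comm n A B x = mat_deriv n B x + comm (A x) (B x)"

section \<open>The series \<open>Y\<close> and the matrices \<open>Z\<^bsub>j,0\<^esub>\<close>\<close>

text \<open>
  A formal series \<open>\<Sum>\<^bsub>i \<le> m\<^esub> A\<^sub>i \<lambda>\<^sup>i\<close> with matrix coefficients is a matrix over the formal Laurent
  series in \<open>X = \<lambda>\<^sup>-\<^sup>1\<close>; thus \<open>\<lambda>\<close> is \<^term>\<open>fls_X_inv\<close>, and the coefficient of \<open>\<lambda>\<^sup>i\<close> is the one of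
  \<open>X\<^sup>-\<^sup>i\<close>.
\<close>

abbreviation lam :: "real fls" where
  "lam \<equiv> fls_X_inv"

definition lam_coeff :: "int \<Rightarrow> real fls mat \<Rightarrow> real mat" where
  "lam_coeff i A = map_mat (\<lambda>f. fls_nth f (- i)) A"

definition Jmat :: "nat \<Rightarrow> real fls mat" where
  "Jmat n = lam \<cdot>\<^sub>m e1n n + bmat n"

definition is_Y :: "nat \<Rightarrow> (real \<Rightarrow> real mat) \<Rightarrow> (real \<Rightarrow> real fls mat) \<Rightarrow> bool" where
  "is_Y n u Y \<longleftrightarrow>
     (\<forall>x. Y x \<in> carrier_mat n n) \<and>
     (\<forall>i. smooth_mat n (\<lambda>x. lam_coeff i (Y x))) \<and>
     (\<forall>i x. lam_coeff i (Y x) \<in> sl n) \<and>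
     (\<forall>x. lam_coeff 1 (Y x) = e1n n) \<and>
     (\<forall>i>1. \<forall>x. lam_coeff i (Y x) = 0\<^sub>m n n) \<and>
     (\<forall>i x. mat_deriv n (\<lambda>s. lam_coeff i (Y s)) x
              + lam_coeff i (comm (Jmat n + map_mat fls_const (u x)) (Y x)) = 0\<^sub>m n n) \<and>
     (\<forall>x. Y x ^\<^sub>m n = lam \<cdot>\<^sub>m 1\<^sub>m n)"

definition Yser :: "nat \<Rightarrow> (real \<Rightarrow> real mat) \<Rightarrow> real \<Rightarrow> real fls mat" where
  "Yser n u = (THE Y. is_Y n u Y)"

definition Ycoeff :: "nat \<Rightarrow> nat \<Rightarrow> int \<Rightarrow> (real \<Rightarrow> real mat) \<Rightarrow> real \<Rightarrow> real mat" where
  "Ycoeff n j i u x = lam_coeff i (Yser n u x ^\<^sub>m j)"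

definition is_zeta ::
  "nat \<Rightarrow> nat \<Rightarrow> (real \<Rightarrow> real mat) \<Rightarrow> (real \<Rightarrow> real mat) \<Rightarrow> bool" where
  "is_zeta n j u \<zeta> \<longleftrightarrow>
     (\<forall>x. \<zeta> x \<in> strictly_upper n) \<and>
     smooth_mat n \<zeta> \<and>
     (\<forall>x. dx_comm n (\<lambda>s. bmat n + u s) (\<lambda>s. Ycoeff n j 0 u s - \<zeta> s) x \<in> V n)"

definition zeta :: "nat \<Rightarrow> nat \<Rightarrow> (real \<Rightarrow> real mat) \<Rightarrow> real \<Rightarrow> real mat" where
  "zeta n j u = (THE \<zeta>. is_zeta n j u \<zeta>)"

definition Z0 :: "nat \<Rightarrow> nat \<Rightarrow> (real \<Rightarrow> real mat) \<Rightarrow> real \<Rightarrow> real mat" where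
  "Z0 n j u x = Ycoeff n j 0 u x - zeta n j u x"

section \<open>The KdV flow\<close>

definition KdV_flow_solution :: "nat \<Rightarrow> nat \<Rightarrow> (real \<Rightarrow> real \<Rightarrow> real mat) \<Rightarrow> bool" where
  "KdV_flow_solution n j u \<longleftrightarrow>
     (\<forall>x t. u x t \<in> V n) \<and> smooth2_mat n u \<and>
     (\<forall>x t. mat_deriv n (\<lambda>s. u x s) t =
        dx_comm n (\<lambda>s. bmat n + u s t) (Z0 n j (\<lambda>s. u s t)) x)"

section \<open>Central affine curves and their flows\<close>

definition moving_frame :: "nat \<Rightarrow> (real \<Rightarrow> real vec) \<Rightarrow> real \<Rightarrow> real mat" where
  "moving_frame n \<gamma> x = mat n n (\<lambda>(p, k). (deriv ^^ k) (\<lambda>s. \<gamma> s $ p) x)"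

definition M :: "nat \<Rightarrow> (real \<Rightarrow> real vec) set" where
  "M n = {\<gamma>. (\<forall>x. \<gamma> x \<in> carrier_vec n - {0\<^sub>v n}) \<and> (\<forall>p<n. smooth (\<lambda>x. \<gamma> x $ p)) \<and>
             (\<forall>x. det (moving_frame n \<gamma> x) = 1)}"

definition curvature :: "nat \<Rightarrow> (real \<Rightarrow> real vec) \<Rightarrow> real \<Rightarrow> real mat" where
  "curvature n \<gamma> x = (THE A. A \<in> V n \<and>
     (\<forall>p<n. (deriv ^^ n) (\<lambda>s. \<gamma> s $ p) x =
        (\<Sum>i<n-1. A $$ (i, n - 1) * (deriv ^^ i) (\<lambda>s. \<gamma> s $ p) x)))"

definition curve_flow_solution :: "nat \<Rightarrow> nat \<Rightarrow> (real \<Rightarrow> real \<Rightarrow> real vec) \<Rightarrow> bool" where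
  "curve_flow_solution n j \<gamma> \<longleftrightarrow>
     (\<forall>p<n. smooth2 (\<lambda>x t. \<gamma> x t $ p)) \<and>
     (\<forall>t. (\<lambda>x. \<gamma> x t) \<in> M n) \<and>
     (\<forall>x t. vec_deriv n (\<lambda>s. \<gamma> x s) t =
        moving_frame n (\<lambda>s. \<gamma> s t) x * Z0 n j (curvature n (\<lambda>s. \<gamma> s t)) x *\<^sub>v unit_vec n 0)"

end

theory Submission
  imports Defs
begin

text \<open>
  Since \<open>u\<close> lives in the last column, \<open>g\<^sub>x = g (b + u)\<close> says that each column of \<open>g\<close> but the last
  has the next column as its derivative, so \<open>g\<close> is the moving frame of its first column \<open>\<gamma>\<close>. The last
  column of the equation then expresses \<open>\<gamma>\<^sub>x\<^sup>(\<^sup>n\<^sup>)\<close> through \<open>u\<close>, whose entries are determined because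
  \<open>g\<close> is invertible. The first column of \<open>g\<^sub>t = g Z\<^bsub>j,0\<^esub>(u)\<close> is the curve flow.
\<close>

lemma smooth2_has_real_derivative_x:
  assumes "smooth2 f"
  shows "((\<lambda>s. f s t) has_real_derivative deriv (\<lambda>s. f s t) x) (at x)"
  unfolding DERIV_deriv_iff_real_differentiable real_differentiable_def
  using assms by (cases rule: smooth2.cases) blast

lemma smooth2_deriv_x:
  assumes "smooth2 f"
  shows "smooth2 (\<lambda>x t. deriv (\<lambda>s. f s t) x)"
  using assms
proof (cases rule: smooth2.cases)
  case (1 fx ft)
  then have "(\<lambda>x t. deriv (\<lambda>s. f s t) x) = fx"
    by (intro ext DERIV_imp_deriv)
  with \<open>smooth2 fx\<close> show ?thesis by simp
qed

lemma smooth2_funpow_deriv_x: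
  assumes "smooth2 f"
  shows "smooth2 (\<lambda>x t. (deriv ^^ k) (\<lambda>s. f s t) x)"
proof (induction k)
  case 0
  show ?case using assms by simp
next
  case (Suc k)
  show ?case using smooth2_deriv_x[OF Suc.IH] by simp
qed

lemma smooth2_imp_smooth:
  assumes "smooth2 f"
  shows "smooth (\<lambda>x. f x t)"
  unfolding smooth_def real_differentiable_def
  using smooth2_has_real_derivative_x[OF smooth2_funpow_deriv_x[OF assms]] by blast

lemma mult_mat_vec_unit_vec:
  fixes A :: "'a :: semiring_1 mat"
  assumes "A \<in> carrier_mat m n" and "k < n"
  shows "A *\<^sub>v unit_vec n k = col A k"
  using assms by (intro eq_vecI) auto

lemma mult_mat_vec_left_cancel:
  fixes A :: "'a :: idom mat"
  assumes A: "A \<in> carrier_mat n n" "det A \<noteq> 0"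
    and v: "v \<in> carrier_vec n" and w: "w \<in> carrier_vec n"
    and image_eq: "A *\<^sub>v v = A *\<^sub>v w"
  shows "v = w"
proof -
  have "A *\<^sub>v (v - w) = A *\<^sub>v v - A *\<^sub>v w"
    using A(1) v w by (rule mult_minus_distrib_mat_vec)
  also have "\<dots> = 0\<^sub>v n"
    unfolding image_eq using A(1) w by (intro minus_cancel_vec mult_mat_vec_carrier)
  finally have "v - w = 0\<^sub>v n"
    using det_0_iff_vec_prod_zero[OF A(1)] A(2) v w by (metis minus_carrier_vec)
  then have "(v - w) $ i = 0" if "i < n" for i
    using that by simp
  then show ?thesis
    using v w by (intro eq_vecI) auto
qed

lemma V_carrier_mat: "A \<in> V n \<Longrightarrow> A \<in> carrier_mat n n"
  by (simp add: V_def)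

lemma V_index_eq_0:
  assumes "A \<in> V n" and "p < n" and "q < n" and "\<not> (p < n - 1 \<and> q = n - 1)"
  shows "A $$ (p, q) = 0"
  using assms by (simp add: V_def)

lemma V_eqI:
  assumes A: "A \<in> V n" and B: "B \<in> V n" and last_col: "col A (n - 1) = col B (n - 1)"
  shows "A = B"
proof (rule eq_matI)
  fix p q
  assume "p < dim_row B" "q < dim_col B"
  then have p: "p < n" and q: "q < n"
    using V_carrier_mat[OF B] by auto
  show "A $$ (p, q) = B $$ (p, q)"
  proof (cases "q = n - 1")
    case True
    have "A $$ (p, q) = col A q $ p" "B $$ (p, q) = col B q $ p"
      using V_carrier_mat[OF A] V_carrier_mat[OF B] p q by auto
    then show ?thesis using True last_col by simp
  next
    case False
    then show ?thesis using A B p q by (simp add: V_index_eq_0)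
  qed
qed (use V_carrier_mat[OF A] V_carrier_mat[OF B] in auto)

lemma mult_mat_vec_col_V:
  assumes B: "B \<in> carrier_mat m n" and A: "A \<in> V n" and p: "p < m"
  shows "(B *\<^sub>v col A (n - 1)) $ p = (\<Sum>i<n-1. A $$ (i, n - 1) * B $$ (p, i))"
proof -
  have "(B *\<^sub>v col A (n - 1)) $ p = (\<Sum>i<n. A $$ (i, n - 1) * B $$ (p, i))"
    using B V_carrier_mat[OF A] p
    by (auto simp: scalar_prod_def lessThan_atLeast0 mult.commute intro!: sum.cong)
  also have "\<dots> = (\<Sum>i<n-1. A $$ (i, n - 1) * B $$ (p, i))"
    using A by (intro sum.mono_neutral_right) (auto simp: V_index_eq_0)
  finally show ?thesis .
qed

lemma col_bmat_plus_V:
  assumes u: "u \<in> V n" and k: "Suc k < n"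
  shows "col (bmat n + u) k = unit_vec n (Suc k)"
proof -
  have "u $$ (p, k) = 0" if "p < n" for p
    using k that by (intro V_index_eq_0[OF u]) auto
  then show ?thesis
    using V_carrier_mat[OF u] k by (intro eq_vecI) (auto simp: bmat_def unit_vec_def)
qed

lemma col_bmat_plus_V_last:
  assumes u: "u \<in> V n" and n: "0 < n"
  shows "col (bmat n + u) (n - 1) = col u (n - 1)"
  using V_carrier_mat[OF u] n by (intro eq_vecI) (auto simp: bmat_def)

lemma mat_deriv_carrier_mat [simp]: "mat_deriv n A x \<in> carrier_mat n n"
  by (simp add: mat_deriv_def)

lemma vec_deriv_col:
  assumes "\<And>s. A s \<in> carrier_mat n n" and "k < n"
  shows "vec_deriv n (\<lambda>s. col (A s) k) x = col (mat_deriv n A x) k"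
proof (rule eq_vecI)
  fix p
  assume "p < dim_vec (col (mat_deriv n A x) k)"
  then have p: "p < n" by (simp add: mat_deriv_def)
  then have "col (A s) k $ p = A s $$ (p, k)" for s
    using assms(1)[of s] \<open>k < n\<close> by auto
  then show "vec_deriv n (\<lambda>s. col (A s) k) x $ p = col (mat_deriv n A x) k $ p"
    using p \<open>k < n\<close> by (simp add: vec_deriv_def mat_deriv_def)
qed (simp add: vec_deriv_def mat_deriv_def)

lemma funpow_vec_deriv_index:
  assumes "p < n"
  shows "(vec_deriv n ^^ k) \<gamma> x $ p = (deriv ^^ k) (\<lambda>s. \<gamma> s $ p) x"
  using assms by (induction k arbitrary: x) (simp_all add: vec_deriv_def)

lemma moving_frame_carrier_mat [simp]: "moving_frame n \<gamma> x \<in> carrier_mat n n"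
  by (simp add: moving_frame_def)

lemma moving_frame_dim [simp]:
  "dim_row (moving_frame n \<gamma> x) = n" "dim_col (moving_frame n \<gamma> x) = n"
  by (simp_all add: moving_frame_def)

lemma moving_frame_index:
  assumes "p < n" and "k < n"
  shows "moving_frame n \<gamma> x $$ (p, k) = (vec_deriv n ^^ k) \<gamma> x $ p"
  using assms by (simp add: moving_frame_def funpow_vec_deriv_index)

lemma col_moving_frame_0:
  assumes "\<gamma> x \<in> carrier_vec n" and "0 < n"
  shows "col (moving_frame n \<gamma> x) 0 = \<gamma> x"
  using assms by (intro eq_vecI) (auto simp: moving_frame_def)

lemma M_I:
  fixes \<gamma> :: "real \<Rightarrow> real vec"
  assumes n: "0 < n" and carrier: "\<And>x. \<gamma> x \<in> carrier_vec n"
    and smooth: "\<And>p. p < n \<Longrightarrow> smooth (\<lambda>x. \<gamma> x $ p)"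
    and det: "\<And>x. det (moving_frame n \<gamma> x) = 1"
  shows "\<gamma> \<in> M n"
proof -
  have "\<gamma> x \<noteq> 0\<^sub>v n" for x
  proof
    assume "\<gamma> x = 0\<^sub>v n"
    then have "moving_frame n \<gamma> x *\<^sub>v unit_vec n 0 = 0\<^sub>v n"
      using n by (simp add: mult_mat_vec_unit_vec[of _ n n] col_moving_frame_0 carrier)
    then have "det (moving_frame n \<gamma> x) = 0"
      unfolding det_0_iff_vec_prod_zero[OF moving_frame_carrier_mat]
      using n by (intro exI[of _ "unit_vec n 0"]) simp
    then show False by (simp add: det)
  qed
  then show ?thesis using carrier smooth det by (simp add: M_def)
qed

lemma curvature_altdef:
  assumes "0 < n"
  shows "curvature n \<gamma> x =
    (THE A. A \<in> V n \<and> (vec_deriv n ^^ n) \<gamma> x = moving_frame n \<gamma> x *\<^sub>v col A (n - 1))"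
proof -
  have dim: "dim_vec ((vec_deriv n ^^ n) \<gamma> x) = n"
    using assms by (cases n) (auto simp: vec_deriv_def)
  have "(\<forall>p<n. (deriv ^^ n) (\<lambda>s. \<gamma> s $ p) x =
          (\<Sum>i<n-1. A $$ (i, n - 1) * (deriv ^^ i) (\<lambda>s. \<gamma> s $ p) x)) \<longleftrightarrow>
        (vec_deriv n ^^ n) \<gamma> x = moving_frame n \<gamma> x *\<^sub>v col A (n - 1)" if A: "A \<in> V n" for A
  proof -
    have "(\<Sum>i<n-1. A $$ (i, n - 1) * (deriv ^^ i) (\<lambda>s. \<gamma> s $ p) x) =
        (moving_frame n \<gamma> x *\<^sub>v col A (n - 1)) $ p" if p: "p < n" for p
      unfolding mult_mat_vec_col_V[OF moving_frame_carrier_mat A p] using p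
      by (intro sum.cong) (auto simp: moving_frame_def)
    then show ?thesis
      by (simp add: vec_eq_iff dim funpow_vec_deriv_index del: index_mult_mat_vec)
  qed
  then show ?thesis
    unfolding curvature_def by (intro arg_cong[of _ _ The] ext conj_cong refl)
qed

lemma curvature_eqI:
  assumes n: "0 < n" and A: "A \<in> V n" and det: "det (moving_frame n \<gamma> x) \<noteq> 0"
    and deriv_n: "(vec_deriv n ^^ n) \<gamma> x = moving_frame n \<gamma> x *\<^sub>v col A (n - 1)"
  shows "curvature n \<gamma> x = A"
  unfolding curvature_altdef[OF n]
proof (rule the_equality)
  show "A \<in> V n \<and> (vec_deriv n ^^ n) \<gamma> x = moving_frame n \<gamma> x *\<^sub>v col A (n - 1)"
    using A deriv_n by simp
next
  fix B
  assume B: "B \<in> V n \<and> (vec_deriv n ^^ n) \<gamma> x = moving_frame n \<gamma> x *\<^sub>v col B (n - 1)"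
  have "col B (n - 1) = col A (n - 1)"
  proof (rule mult_mat_vec_left_cancel[OF moving_frame_carrier_mat det])
    show "col B (n - 1) \<in> carrier_vec n" "col A (n - 1) \<in> carrier_vec n"
      using n A B by (simp_all add: col_carrier_vec[OF _ V_carrier_mat])
    show "moving_frame n \<gamma> x *\<^sub>v col B (n - 1) = moving_frame n \<gamma> x *\<^sub>v col A (n - 1)"
      using B deriv_n by metis
  qed
  with B A show "B = A" by (blast intro: V_eqI)
qed

locale central_affine_frame =
  fixes n :: nat and g u :: "real \<Rightarrow> real mat"
  assumes dim_pos: "0 < n"
    and g_carrier: "g x \<in> carrier_mat n n"
    and u_V: "u x \<in> V n"
    and frame_equation: "mat_deriv n g x = g x * (bmat n + u x)"
begin

lemma vec_deriv_col_frame: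
  assumes "k < n"
  shows "vec_deriv n (\<lambda>s. col (g s) k) x = g x *\<^sub>v col (bmat n + u x) k"
proof -
  have "vec_deriv n (\<lambda>s. col (g s) k) x = col (g x * (bmat n + u x)) k"
    using assms by (simp add: vec_deriv_col g_carrier frame_equation)
  also have "\<dots> = g x *\<^sub>v col (bmat n + u x) k"
    using V_carrier_mat[OF u_V] by (intro col_mult2[OF g_carrier _ assms] add_carrier_mat)
  finally show ?thesis .
qed

lemma funpow_vec_deriv_first_col:
  assumes "k < n"
  shows "(vec_deriv n ^^ k) (\<lambda>x. col (g x) 0) = (\<lambda>x. col (g x) k)"
  using assms
proof (induction k)
  case 0
  show ?case by simp
next
  case (Suc k)
  have "vec_deriv n (\<lambda>s. col (g s) k) x = col (g x) (Suc k)" for x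
    using Suc.prems g_carrier[of x] u_V[of x]
    by (simp add: vec_deriv_col_frame col_bmat_plus_V mult_mat_vec_unit_vec)
  with Suc show ?case by auto
qed

lemma moving_frame_first_col: "moving_frame n (\<lambda>x. col (g x) 0) = g"
proof
  fix x
  show "moving_frame n (\<lambda>x. col (g x) 0) x = g x"
    using g_carrier[of x]
    by (intro eq_matI) (auto simp: moving_frame_index funpow_vec_deriv_first_col)
qed

lemma funpow_vec_deriv_first_col_dim:
  "(vec_deriv n ^^ n) (\<lambda>x. col (g x) 0) x = g x *\<^sub>v col (u x) (n - 1)"
proof -
  have "(vec_deriv n ^^ n) (\<lambda>x. col (g x) 0) = vec_deriv n (\<lambda>x. col (g x) (n - 1))"
    using dim_pos funpow_vec_deriv_first_col[of "n - 1"] by (cases n) auto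
  then show ?thesis
    using dim_pos vec_deriv_col_frame[of "n - 1"] col_bmat_plus_V_last[OF u_V] by simp
qed

lemma curvature_first_col:
  assumes "det (g x) \<noteq> 0"
  shows "curvature n (\<lambda>x. col (g x) 0) x = u x"
  using dim_pos u_V assms
  by (intro curvature_eqI) (simp_all add: moving_frame_first_col funpow_vec_deriv_first_col_dim)

end

theorem theorem3p1:
  fixes n j :: nat
    and u :: "real \<Rightarrow> real \<Rightarrow> real mat"
    and c0 :: "real mat"
    and g :: "real \<Rightarrow> real \<Rightarrow> real mat"
    and \<gamma> :: "real \<Rightarrow> real \<Rightarrow> real vec"
  assumes "n \<ge> 2" and "j \<ge> 1" and "j mod n \<noteq> 0"
    and "KdV_flow_solution n j u"
    and "c0 \<in> SL n"
    and "\<And>x t. g x t \<in> SL n"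
    and "smooth2_mat n g"
    and "\<And>x t. mat_deriv n (\<lambda>s. g s t) x = g x t * (bmat n + u x t)"
    and "\<And>x t. mat_deriv n (\<lambda>s. g x s) t = g x t * Z0 n j (\<lambda>s. u s t) x"
    and "g 0 0 = c0"
    and "\<And>x t. \<gamma> x t = g x t *\<^sub>v unit_vec n 0"
  shows "curve_flow_solution n j \<gamma> \<and> (\<forall>t. curvature n (\<lambda>x. \<gamma> x t) = (\<lambda>x. u x t))"
proof -
  have n: "0 < n" using assms(1) by simp
  have g: "g x t \<in> carrier_mat n n" and det: "det (g x t) = 1" for x t
    using assms(6) by (auto simp: SL_def)
  interpret frame: central_affine_frame n "\<lambda>x. g x t" "\<lambda>x. u x t" for t
    using n g assms(4,8) by unfold_locales (simp_all add: KdV_flow_solution_def)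
  have \<gamma>: "\<gamma> = (\<lambda>x t. col (g x t) 0)"
    by (simp add: fun_eq_iff assms(11) mult_mat_vec_unit_vec[OF g n])
  have \<gamma>_carrier: "\<gamma> x t \<in> carrier_vec n" for x t
    unfolding \<gamma> using n g by (rule col_carrier_vec)
  have moving_frame: "moving_frame n (\<lambda>x. \<gamma> x t) = (\<lambda>x. g x t)" for t
    unfolding \<gamma> by (rule frame.moving_frame_first_col)
  have curvature: "curvature n (\<lambda>x. \<gamma> x t) = (\<lambda>x. u x t)" for t
    unfolding \<gamma> by (intro ext frame.curvature_first_col) (simp add: det)
  have smooth: "smooth2 (\<lambda>x t. \<gamma> x t $ p)" if "p < n" for p
    using assms(7) n that g[THEN carrier_matD(1)] g[THEN carrier_matD(2)]
    by (simp add: \<gamma> smooth2_mat_def)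
  have "(\<lambda>x. \<gamma> x t) \<in> M n" for t
    using n \<gamma>_carrier smooth2_imp_smooth[OF smooth] by (rule M_I) (simp_all add: moving_frame det)
  moreover have "vec_deriv n (\<lambda>s. \<gamma> x s) t = mat_deriv n (\<lambda>s. g x s) t *\<^sub>v unit_vec n 0" for x t
    using n g by (simp add: \<gamma> vec_deriv_col mult_mat_vec_unit_vec[of _ n n])
  ultimately show ?thesis
    using smooth by (simp add: curve_flow_solution_def moving_frame curvature assms(9))
qed

end
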